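(* Let $H$ be a complex separable Hilbert space, and let $PI_1(H)$ be the set of all rank-1 partial isometries on $H$. Let $\phi: PI_1(H)\to PI_1(H)$ be a bijective function with the property that $$\operatorname{tr}\, \phi(P)^*\phi(Q)=\operatorname{tr}\, P^*Q\qquad (P,Q\in PI_1(H)).$$ Then $\phi$ is of one of the following forms: (a) there exist unitaries $U,V$ on $H$ such that $\phi(R)=URV$ for all $R\in PI_1(H)$; (b) there exist antiunitaries $U,V$ on $H$ such that $\phi(R)=UR^*V$ for all $R\in PI_1(H)$.
   Context: $B(H)$ denotes the algebra of all bounded linear operators on $H$. An operator $U\in B(H)$ is called a partial isometry if there is a closed subspace $I_U$ of $H$ such that $U$ acts as an isometry on $I_U$ and $U$ is zero on $I_U^\perp$. $PI_1(H)$ denotes the set of all partial isometries on $H$ whose range is one-dimensional. $\operatorname{tr}$ denotes the usual trace functional on trace class operators, and $R^*$ denotes the Hilbert space adjoint of $R$. A unitary operator is a linear norm preserving bijection on $H$; an antiunitary operator is a conjugate-linear norm preserving bijection on $H$. *)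

theory Defs
  imports "HOL-Analysis.Analysis"
begin

text \<open>The inner product is linear in its first argument.\<close>
class complex_inner = real_normed_vector +
  fixes scaleC :: "complex \<Rightarrow> 'a \<Rightarrow> 'a" (infixr \<open>*\<^sub>C\<close> 75)
    and cinner :: "'a \<Rightarrow> 'a \<Rightarrow> complex"
  assumes scaleC_add_right: "a *\<^sub>C (x + y) = a *\<^sub>C x + a *\<^sub>C y"
    and scaleC_add_left: "(a + b) *\<^sub>C x = a *\<^sub>C x + b *\<^sub>C x"
    and scaleC_scaleC: "a *\<^sub>C b *\<^sub>C x = (a * b) *\<^sub>C x"
    and scaleC_one: "1 *\<^sub>C x = x"
    and scaleR_scaleC: "r *\<^sub>R x = complex_of_real r *\<^sub>C x"
    and cinner_commute: "cinner x y = cnj (cinner y x)"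
    and cinner_add_left: "cinner (x + y) z = cinner x z + cinner y z"
    and cinner_scaleC_left: "cinner (a *\<^sub>C x) y = a * cinner x y"
    and cinner_self_real_nonneg: "cinner x x \<in> \<real> \<and> 0 \<le> Re (cinner x x)"
    and cinner_eq_zero_iff: "cinner x x = 0 \<longleftrightarrow> x = 0"
    and norm_eq_sqrt_cinner: "norm x = sqrt (Re (cinner x x))"

class complex_hilbert_space = complex_inner + complete_space

global_interpretation complex_vector:
  vector_space "scaleC :: complex \<Rightarrow> 'a \<Rightarrow> 'a::complex_inner"
  defines csubspace = complex_vector.subspace
    and cspan = complex_vector.span
    and cdim = complex_vector.dim
  by unfold_locales
    (simp_all add: scaleC_add_right scaleC_add_left scaleC_scaleC scaleC_one)

instantiation complex :: complex_hilbert_space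
begin

definition scaleC_complex :: "complex \<Rightarrow> complex \<Rightarrow> complex" where
  "scaleC_complex a x = a * x"

definition cinner_complex :: "complex \<Rightarrow> complex \<Rightarrow> complex" where
  "cinner_complex x y = x * cnj y"

instance
  by standard
    (auto simp: scaleC_complex_def cinner_complex_def algebra_simps scaleR_conv_of_real
      cmod_def power2_eq_square complex_is_Real_iff)

end

abbreviation clinear :: "('a::complex_inner \<Rightarrow> 'b::complex_inner) \<Rightarrow> bool" where
  "clinear \<equiv> Vector_Spaces.linear scaleC scaleC"

definition antilinear :: "('a::complex_inner \<Rightarrow> 'b::complex_inner) \<Rightarrow> bool" where
  "antilinear f \<longleftrightarrow> (\<forall>x y. f (x + y) = f x + f y) \<and> (\<forall>c x. f (c *\<^sub>C x) = cnj c *\<^sub>C f x)"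

definition bounded_operators :: "('a::complex_inner \<Rightarrow> 'a) set" where
  "bounded_operators = {T. clinear T \<and> bounded_linear T}"

definition ortho_complement :: "'a::complex_inner set \<Rightarrow> 'a set" where
  "ortho_complement I = {x. \<forall>y\<in>I. cinner x y = 0}"

definition partial_isometry :: "('a::complex_inner \<Rightarrow> 'a) \<Rightarrow> bool" where
  "partial_isometry U \<longleftrightarrow> U \<in> bounded_operators \<and>
     (\<exists>I. csubspace I \<and> closed I \<and> (\<forall>x\<in>I. norm (U x) = norm x) \<and>
          (\<forall>x\<in>ortho_complement I. U x = 0))"

definition PI1 :: "('a::complex_inner \<Rightarrow> 'a) set" where
  "PI1 = {U. partial_isometry U \<and> cdim (range U) = 1}"

definition cadjoint :: "('a::complex_inner \<Rightarrow> 'a) \<Rightarrow> 'a \<Rightarrow> 'a" where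
  "cadjoint T = (THE S. \<forall>x y. cinner (T x) y = cinner x (S y))"

definition orthonormal_basis :: "'a::complex_inner set \<Rightarrow> bool" where
  "orthonormal_basis B \<longleftrightarrow> (\<forall>x\<in>B. \<forall>y\<in>B. cinner x y = (if x = y then 1 else 0)) \<and>
     closure (cspan B) = UNIV"

text \<open>
  On trace class operators the sum converges absolutely and its value does not depend on the
  orthonormal basis; on other operators the value of \<open>tr\<close> is without meaning.
\<close>
definition tr :: "('a::complex_inner \<Rightarrow> 'a) \<Rightarrow> complex" where
  "tr T = (\<Sum>\<^sub>\<infinity>e\<in>(SOME B. orthonormal_basis B). cinner (T e) e)"

definition unitary :: "('a::complex_inner \<Rightarrow> 'a) \<Rightarrow> bool" where
  "unitary U \<longleftrightarrow> clinear U \<and> (\<forall>x. norm (U x) = norm x) \<and> bij U"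

definition antiunitary :: "('a::complex_inner \<Rightarrow> 'a) \<Rightarrow> bool" where
  "antiunitary U \<longleftrightarrow> antilinear U \<and> (\<forall>x. norm (U x) = norm x) \<and> bij U"

end

theory Submission
  imports Defs
begin

text \<open>
  A partial isometry of rank one has the form \<open>x \<otimes> y = (\<lambda>z. \<langle>z,y\<rangle> x)\<close> with unit vectors \<open>x\<close> and \<open>y\<close>
  (\<open>PI1_outer\<close>), and the trace form factorizes: \<open>tr ((x \<otimes> y)\<^sup>* (u \<otimes> v)) = \<langle>u,x\<rangle> \<langle>y,v\<rangle>\<close>
  (\<open>hs_outer\<close>). Up to phases \<open>PI1\<close> is thus a grid: the row of an operator is its range, the line of
  \<open>x\<close>, and the column is its kernel, the orthogonal complement of \<open>y\<close>.

  Two operators that share a row or a column are called adjacent. Adjacency can be expressed by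
  orthogonality and by values of modulus one of the trace form (\<open>adjacent_iff\<close>), so \<open>\<phi>\<close> preserves
  it in both directions. A map of a grid with this property preserves rows and columns or swaps
  them (\<open>rook_map\<close>).

  If rows and columns are preserved, then \<open>\<phi> (x \<otimes> y)\<close> is \<open>U x \<otimes> W y\<close> up to a phase, where \<open>U\<close> and
  \<open>W\<close> are read off from the column and the row through a fixed \<open>e \<otimes> e\<close>. The trace form makes \<open>U\<close>
  and \<open>W\<close> preserve inner products, so they extend from the unit sphere to unitaries
  (\<open>sphere_map_extends\<close>), and it forces the phase to be 1, because any two unit vectors are both
  non-orthogonal to some third one (\<open>phase_rigidity\<close>). Then \<open>\<phi> R = U R W\<^sup>-\<^sup>1\<close>.

  If they are swapped, the same argument applies to \<open>P \<mapsto> \<phi>(P)\<^sup>*\<close>, which preserves rows and columns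
  but conjugates the trace form, so that \<open>U\<close> and \<open>W\<close> are antiunitary and \<open>\<phi> R = W R\<^sup>* U\<^sup>-\<^sup>1\<close>.
\<close>

section \<open>Complex inner products\<close>

lemma cinner_add_right: "cinner x (y + z) = cinner x y + cinner x z"
  by (metis cinner_add_left cinner_commute complex_cnj_add)

lemma cinner_scaleC_right: "cinner x (a *\<^sub>C y) = cnj a * cinner x y"
  by (metis cinner_commute cinner_scaleC_left complex_cnj_mult)

lemma cinner_zero_left [simp]: "cinner 0 x = 0"
  using cinner_add_left[of 0 0 x] by simp

lemma cinner_zero_right [simp]: "cinner x 0 = 0"
  using cinner_add_right[of x 0 0] by simp

lemma cinner_diff_left: "cinner (x - y) z = cinner x z - cinner y z"
  using cinner_add_left[of "x - y" y z] by (simp add: algebra_simps)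

lemma cinner_diff_right: "cinner z (x - y) = cinner z x - cinner z y"
  using cinner_add_right[of z "x - y" y] by (simp add: algebra_simps)

lemma cinner_sum_left: "cinner (sum f A) z = (\<Sum>i\<in>A. cinner (f i) z)"
  by (induction A rule: infinite_finite_induct) (auto simp: cinner_add_left)

lemmas cinner_simps = cinner_add_left cinner_add_right cinner_diff_left cinner_diff_right
  cinner_scaleC_left cinner_scaleC_right

lemma cinner_self: "cinner x x = complex_of_real ((norm x)\<^sup>2)"
proof -
  have "Im (cinner x x) = 0"
    using cinner_self_real_nonneg[of x] by (simp add: complex_is_Real_iff)
  moreover have "Re (cinner x x) = (norm x)\<^sup>2"
    using cinner_self_real_nonneg[of x] by (simp add: norm_eq_sqrt_cinner)
  ultimately show ?thesis by (simp add: complex_eq_iff)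
qed

lemma cinner_self_unit: "norm x = 1 \<Longrightarrow> cinner x x = 1"
  by (simp add: cinner_self)

lemma cinner_swap_zero: "cinner x y = 0 \<longleftrightarrow> cinner y x = 0"
  by (metis cinner_commute complex_cnj_zero)

lemma cmod_cinner_commute: "cmod (cinner x y) = cmod (cinner y x)"
  by (metis cinner_commute complex_mod_cnj)

lemma norm_scaleC: "norm (a *\<^sub>C x) = cmod a * norm x"
proof -
  have "complex_of_real ((norm (a *\<^sub>C x))\<^sup>2) = (a * cnj a) * cinner x x"
    by (simp only: cinner_self[symmetric] cinner_simps mult_ac)
  also have "\<dots> = complex_of_real ((cmod a * norm x)\<^sup>2)"
    by (simp add: cinner_self complex_norm_square[symmetric] power_mult_distrib)
  finally have "(norm (a *\<^sub>C x))\<^sup>2 = (cmod a * norm x)\<^sup>2"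
    using of_real_eq_iff by blast
  then show ?thesis by simp
qed

lemma normalize_unit: "x \<noteq> 0 \<Longrightarrow> norm (complex_of_real (inverse (norm x)) *\<^sub>C x) = 1"
  by (simp add: norm_scaleC norm_inverse)

lemma scaleC_norm_normalize:
  "complex_of_real (norm x) *\<^sub>C complex_of_real (inverse (norm x)) *\<^sub>C x = x"
  by (cases "x = 0") (simp_all flip: of_real_mult)

text \<open>For a unit vector \<open>u\<close> the vector \<open>x - \<langle>x,u\<rangle>u\<close> is the component of \<open>x\<close> orthogonal to \<open>u\<close>;
  its squared length is the defect in the Cauchy-Schwarz inequality.\<close>
lemma norm_sq_orthogonal_part:
  assumes "norm u = 1"
  shows "(norm (x - cinner x u *\<^sub>C u))\<^sup>2 = (norm x)\<^sup>2 - (cmod (cinner x u))\<^sup>2"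
proof -
  have "cinner (x - cinner x u *\<^sub>C u) (x - cinner x u *\<^sub>C u)
      = cinner x x - cinner x u * cnj (cinner x u)"
    using assms cinner_commute[of u x] by (simp add: cinner_simps cinner_self_unit)
  then have "complex_of_real ((norm (x - cinner x u *\<^sub>C u))\<^sup>2)
      = complex_of_real ((norm x)\<^sup>2 - (cmod (cinner x u))\<^sup>2)"
    by (simp only: cinner_self complex_norm_square[symmetric] of_real_diff)
  then show ?thesis using of_real_eq_iff by blast
qed

lemma norm_cinner_le: "cmod (cinner x y) \<le> norm x * norm y"
proof (cases "y = 0")
  case False
  define u where "u = complex_of_real (inverse (norm y)) *\<^sub>C y"
  have u: "norm u = 1" unfolding u_def using False by (rule normalize_unit)
  have "(cmod (cinner x u))\<^sup>2 \<le> (norm x)\<^sup>2"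
    using norm_sq_orthogonal_part[OF u, of x] zero_le_power2[of "norm (x - cinner x u *\<^sub>C u)"]
    by linarith
  then have "cmod (cinner x u) \<le> norm x" by (rule power2_le_imp_le) simp
  moreover have "y = complex_of_real (norm y) *\<^sub>C u"
    unfolding u_def by (rule scaleC_norm_normalize[symmetric])
  then have "cinner x y = complex_of_real (norm y) * cinner x u"
    by (metis cinner_scaleC_right complex_cnj_complex_of_real)
  then have "cmod (cinner x y) = cmod (cinner x u) * norm y"
    by (simp add: norm_mult)
  ultimately show ?thesis
    by (simp add: mult_right_mono)
qed simp

lemma unit_aligned:
  assumes "norm x = 1" "norm u = 1" "cmod (cinner x u) = 1"
  shows "x = cinner x u *\<^sub>C u"
  using norm_sq_orthogonal_part[OF assms(2), of x] assms by simp

lemma orthogonal_part_cinner: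
  assumes "norm u = 1"
  shows "cinner (x - cinner x u *\<^sub>C u) u = 0"
  using assms by (simp add: cinner_simps cinner_self_unit)

text \<open>The component of \<open>x\<close> orthogonal to \<open>u\<close> serves. In this way the line of a unit vector is
  recovered from orthogonality alone.\<close>
lemma separating_orthogonal_unit:
  assumes "norm u = 1" "norm x = 1" "cmod (cinner x u) \<noteq> 1"
  obtains a where "norm a = 1" "cinner a u = 0" "cinner a x \<noteq> 0"
proof -
  define z where "z = x - cinner x u *\<^sub>C u"
  have "(norm z)\<^sup>2 \<noteq> 0"
    using norm_sq_orthogonal_part[OF assms(1), of x] assms
    by (simp add: z_def) (metis norm_ge_zero power2_eq_1_iff
        le_minus_one_simps(3))
  then have "z \<noteq> 0" by simp
  have zu: "cinner z u = 0" unfolding z_def by (rule orthogonal_part_cinner[OF assms(1)])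
  then have "cinner z x = cinner z z"
    by (simp add: z_def cinner_simps)
  with \<open>z \<noteq> 0\<close> have zx: "cinner z x \<noteq> 0" by (simp add: cinner_eq_zero_iff)
  show thesis
    using \<open>z \<noteq> 0\<close> zu zx
    by (intro that[OF normalize_unit[of z]]) (simp_all add: cinner_simps)
qed

section \<open>Orthonormal bases and Parseval's identity\<close>

definition orthonormal :: "'a::complex_inner set \<Rightarrow> bool" where
  "orthonormal B \<longleftrightarrow> (\<forall>x\<in>B. \<forall>y\<in>B. cinner x y = (if x = y then 1 else 0))"

lemma orthonormal_basis_iff:
  "orthonormal_basis B \<longleftrightarrow> orthonormal B \<and> closure (cspan B) = UNIV"
  unfolding orthonormal_basis_def orthonormal_def by (rule refl)

text \<open>For orthonormal \<open>F\<close>, the sum is the orthogonal projection of \<open>x\<close> onto the span of \<open>F\<close>.\<close>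
definition residual :: "'a::complex_inner set \<Rightarrow> 'a \<Rightarrow> 'a" where
  "residual F x = x - (\<Sum>e\<in>F. cinner x e *\<^sub>C e)"

lemma orthonormal_subset: "orthonormal B \<Longrightarrow> F \<subseteq> B \<Longrightarrow> orthonormal F"
  unfolding orthonormal_def by blast

lemma residual_orthogonal:
  assumes "finite F" "orthonormal F" "w \<in> cspan F"
  shows "cinner (residual F x) w = 0"
  using assms(3)
proof (induction rule: complex_vector.span_induct_alt)
  case (step c f w)
  have "(\<Sum>e\<in>F. cinner x e * cinner e f) = (\<Sum>e\<in>F. if e = f then cinner x f else 0)"
    using assms(2) step.hyps by (intro sum.cong) (auto simp: orthonormal_def)
  then have "cinner (residual F x) f = 0"
    using assms(1) step.hyps by (simp add: residual_def cinner_simps cinner_sum_left)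
  then show ?case using step by (simp add: cinner_simps)
qed simp

lemma diff_residual_in_span: "x - residual F x \<in> cspan F"
proof -
  have "(\<Sum>e\<in>F. cinner x e *\<^sub>C e) \<in> cspan F"
    by (intro complex_vector.span_sum complex_vector.span_scale complex_vector.span_base)
  then show ?thesis by (simp add: residual_def)
qed

lemma norm_residual_le:
  assumes "finite F" "orthonormal F"
  shows "norm (residual F x) \<le> norm x"
proof -
  have "cinner (residual F x) (residual F x) = cinner (residual F x) x"
    using residual_orthogonal[OF assms diff_residual_in_span[of x F], of x]
    by (simp add: cinner_diff_right)
  then have "norm (residual F x) * norm (residual F x) \<le> norm (residual F x) * norm x"
    using norm_cinner_le[of "residual F x" x]
    by (metis abs_power2 cinner_self norm_of_real power2_eq_square)
  then show ?thesis
    by (cases "residual F x = 0") auto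
qed

lemma span_finite_subset:
  assumes "w \<in> cspan B"
  obtains F where "finite F" "F \<subseteq> B" "w \<in> cspan F"
proof -
  have "\<exists>F. finite F \<and> F \<subseteq> B \<and> w \<in> cspan F"
    using assms
  proof (induction rule: complex_vector.span_induct_alt)
    case base
    show ?case by (intro exI[of _ "{}"]) (simp add: complex_vector.span_zero)
  next
    case (step c b w)
    then obtain F where F: "finite F" "F \<subseteq> B" "w \<in> cspan F" by blast
    have "w \<in> cspan (insert b F)"
      using F(3) complex_vector.span_mono[of F "insert b F"] by blast
    then have "c *\<^sub>C b + w \<in> cspan (insert b F)"
      by (simp add: complex_vector.span_add complex_vector.span_scale complex_vector.span_base)
    then show ?case using F step.hyps by (intro exI[of _ "insert b F"]) auto
  qed
  then show thesis using that by blast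
qed

text \<open>The partial sum over \<open>F\<close> misses \<open>\<langle>y,v\<rangle>\<close> by \<open>\<langle>residual F y, v\<rangle>\<close>. The residual is orthogonal
  to the span of \<open>F\<close>, so \<open>v\<close> may be replaced by its difference from a vector of that span, which is
  small for a suitable vector once \<open>F\<close> is large.\<close>
lemma Parseval:
  assumes "orthonormal_basis B"
  shows "((\<lambda>e. cinner y e * cinner e v) has_sum cinner y v) B"
  unfolding has_sum_def tendsto_iff
proof (intro allI impI)
  fix \<epsilon> :: real
  assume "\<epsilon> > 0"
  have B: "orthonormal B" "closure (cspan B) = UNIV"
    using assms by (simp_all add: orthonormal_basis_iff)
  have pos: "norm y + 1 > 0" by (simp add: add_nonneg_pos)
  then have "\<epsilon> / (norm y + 1) > 0" using \<open>\<epsilon> > 0\<close> by simp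
  moreover have "v \<in> closure (cspan B)" using B(2) by simp
  ultimately obtain w where w: "w \<in> cspan B" "dist w v < \<epsilon> / (norm y + 1)"
    using closure_approachable by blast
  obtain F where F: "finite F" "F \<subseteq> B" "w \<in> cspan F" using span_finite_subset[OF w(1)] .
  show "\<forall>\<^sub>F G in finite_subsets_at_top B. dist (\<Sum>e\<in>G. cinner y e * cinner e v) (cinner y v) < \<epsilon>"
    unfolding eventually_finite_subsets_at_top
  proof (intro exI[of _ F] conjI allI impI)
    fix G assume G: "finite G \<and> F \<subseteq> G \<and> G \<subseteq> B"
    have oG: "orthonormal G" using G B(1) orthonormal_subset by blast
    have "w \<in> cspan G" using G F(3) complex_vector.span_mono[of F G] by blast
    then have "cinner (residual G y) w = 0"
      using residual_orthogonal oG G by blast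
    then have "cinner y v - (\<Sum>e\<in>G. cinner y e * cinner e v) = cinner (residual G y) (v - w)"
      by (simp add: residual_def cinner_simps cinner_sum_left)
    then have "dist (\<Sum>e\<in>G. cinner y e * cinner e v) (cinner y v) = cmod (cinner (residual G y) (v - w))"
      by (metis dist_commute dist_norm)
    also have "\<dots> \<le> norm (residual G y) * norm (v - w)" by (rule norm_cinner_le)
    also have "\<dots> \<le> (norm y + 1) * norm (v - w)"
      using norm_residual_le[of G y] G oG by (intro mult_right_mono) auto
    also have "\<dots> < \<epsilon>"
      using w(2) pos by (simp add: dist_norm norm_minus_commute pos_less_divide_eq mult.commute)
    finally show "dist (\<Sum>e\<in>G. cinner y e * cinner e v) (cinner y v) < \<epsilon>" .
  qed (use F in auto)
qed

lemma Gram_Schmidt_step: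
  assumes "finite F" "orthonormal F"
  obtains G where "finite G" "orthonormal G" "F \<subseteq> G" "d \<in> cspan G"
proof (cases "residual F d = 0")
  case True
  then show thesis using that[OF assms] diff_residual_in_span[of d F] by simp
next
  case False
  define r where "r = residual F d"
  define u where "u = complex_of_real (inverse (norm r)) *\<^sub>C r"
  have u: "norm u = 1" unfolding u_def using False by (intro normalize_unit) (simp add: r_def)
  have perp: "cinner u f = 0" if "f \<in> F" for f
    using residual_orthogonal[OF assms complex_vector.span_base[OF that], of d]
    by (simp add: u_def r_def cinner_simps)
  have "u \<notin> F" using perp[of u] cinner_self_unit[OF u] by auto
  then have "orthonormal (insert u F)"
    using assms(2) perp cinner_self_unit[OF u] cinner_swap_zero[of u]
    unfolding orthonormal_def by (metis insert_iff)
  moreover have "d \<in> cspan (insert u F)"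
  proof -
    have "d - r \<in> cspan (insert u F)"
      using diff_residual_in_span[of d F] complex_vector.span_mono[of F "insert u F"]
      by (auto simp: r_def)
    moreover have "r \<in> cspan (insert u F)"
      using complex_vector.span_scale[OF complex_vector.span_base[of u "insert u F"],
          of "complex_of_real (norm r)"]
      by (simp only: u_def scaleC_norm_normalize insertI1)
    ultimately show ?thesis using complex_vector.span_add by fastforce
  qed
  ultimately show thesis using that[of "insert u F"] assms(1) by blast
qed

text \<open>Gram-Schmidt along a dense sequence: every term of the sequence lies in the span of the
  resulting set, so that span is dense.\<close>
lemma orthonormal_basis_exists:
  assumes "separable_space (euclidean :: 'a::complex_inner topology)"
  shows "\<exists>B :: 'a set. orthonormal_basis B"
proof -
  obtain D :: "'a set" where D: "countable D" "closure D = UNIV"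
    using assms unfolding separable_space_def by auto
  have "D \<noteq> {}" using D(2) by auto
  define P where "P = (\<lambda>(n::nat) F :: 'a set. finite F \<and> orthonormal F)"
  have "\<exists>f. \<forall>n. P n (f n) \<and> (f n \<subseteq> f (Suc n) \<and> from_nat_into D n \<in> cspan (f (Suc n)))"
  proof (rule dependent_nat_choice)
    show "\<exists>F. P 0 F" by (intro exI[of _ "{}"]) (simp add: P_def orthonormal_def)
  next
    fix F n assume "P n F"
    then show "\<exists>G. P (Suc n) G \<and> (F \<subseteq> G \<and> from_nat_into D n \<in> cspan G)"
      using Gram_Schmidt_step[of F "from_nat_into D n"] unfolding P_def by metis
  qed
  then obtain f where f: "\<And>n. orthonormal (f n)" "\<And>n. f n \<subseteq> f (Suc n)"
    "\<And>n. from_nat_into D n \<in> cspan (f (Suc n))"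
    unfolding P_def by blast
  define B where "B = (\<Union>n. f n)"
  have mono: "f m \<subseteq> f n" if "m \<le> n" for m n
    using f(2) that by (rule lift_Suc_mono_le)
  have "orthonormal B"
    unfolding orthonormal_def
  proof (intro ballI)
    fix x y assume "x \<in> B" "y \<in> B"
    then obtain m n where "x \<in> f m" "y \<in> f n" by (auto simp: B_def)
    then have "x \<in> f (max m n)" "y \<in> f (max m n)"
      using mono[of m "max m n"] mono[of n "max m n"] by auto
    then show "cinner x y = (if x = y then 1 else 0)"
      using f(1)[of "max m n"] by (simp add: orthonormal_def)
  qed
  moreover have "D \<subseteq> cspan B"
  proof
    fix d assume "d \<in> D"
    then obtain n where "d = from_nat_into D n"
      using from_nat_into_surj[OF D(1)] by metis
    then show "d \<in> cspan B"
      using f(3)[of n] complex_vector.span_mono[of "f (Suc n)" B] by (auto simp: B_def)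
  qed
  then have "closure (cspan B) = UNIV"
    using closure_mono[of D "cspan B"] D(2) by auto
  ultimately show ?thesis by (auto simp: orthonormal_basis_iff)
qed

section \<open>Rank-one partial isometries\<close>

definition outer :: "'a::complex_inner \<Rightarrow> 'a \<Rightarrow> 'a \<Rightarrow> 'a" (infix \<open>\<otimes>\<close> 70) where
  "x \<otimes> y = (\<lambda>z. cinner z y *\<^sub>C x)"

lemma clinearI:
  assumes "\<And>x y. f (x + y) = f x + f y" "\<And>c x. f (c *\<^sub>C x) = c *\<^sub>C f x"
  shows "clinear f"
  using assms by unfold_locales auto

lemma outer_bounded: "x \<otimes> y \<in> bounded_operators"
proof -
  have "clinear (x \<otimes> y)"
    by (rule clinearI) (simp_all add: outer_def cinner_simps scaleC_add_left)
  moreover have "bounded_linear (x \<otimes> y)"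
  proof (rule bounded_linear_intro)
    fix z show "norm ((x \<otimes> y) z) \<le> norm z * (norm y * norm x)"
      using mult_right_mono[OF norm_cinner_le[of z y] norm_ge_zero[of x]]
      by (simp add: outer_def norm_scaleC mult.assoc)
  qed (simp_all add: outer_def cinner_simps scaleC_add_left scaleR_scaleC)
  ultimately show ?thesis by (simp add: bounded_operators_def)
qed

text \<open>The range of \<open>x \<otimes> y\<close> remembers the line of \<open>x\<close>. Likewise its kernel, the orthogonal complement
  of \<open>y\<close>, remembers the line of \<open>y\<close> (see \<open>kernel_outer_eq_iff\<close>).\<close>
lemma range_outer:
  assumes "norm y = 1"
  shows "range (x \<otimes> y) = cspan {x}"
proof -
  have "(x \<otimes> y) (k *\<^sub>C y) = k *\<^sub>C x" for k
    using assms by (simp add: outer_def cinner_simps cinner_self_unit)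
  then have "k *\<^sub>C x \<in> range (x \<otimes> y)" for k by (metis rangeI)
  then show ?thesis
    by (auto simp: complex_vector.span_singleton outer_def)
qed

lemma outer_in_PI1:
  assumes "norm x = 1" "norm y = 1"
  shows "x \<otimes> y \<in> PI1"
proof -
  define I where "I = {z. (y \<otimes> y) z = z}"
  have lin: "clinear (y \<otimes> y)" and bl: "bounded_linear (y \<otimes> y)"
    using outer_bounded[of y y] by (simp_all add: bounded_operators_def)
  interpret Vector_Spaces.linear scaleC scaleC "y \<otimes> y" by (rule lin)
  have "closed I"
    unfolding I_def by (rule closed_Collect_eq[OF linear_continuous_on[OF bl] continuous_on_id])
  moreover have "csubspace I"
    unfolding I_def
    by (rule complex_vector.subspaceI) (simp_all add: zero add scale)
  moreover have "norm ((x \<otimes> y) z) = norm z" if "z \<in> I" for z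
  proof -
    have "norm z = norm ((y \<otimes> y) z)" using that by (simp add: I_def)
    then show ?thesis using assms by (simp add: outer_def norm_scaleC)
  qed
  moreover have "y \<in> I" using assms by (simp add: I_def outer_def cinner_self_unit)
  then have "(x \<otimes> y) z = 0" if "z \<in> ortho_complement I" for z
    using that by (simp add: ortho_complement_def outer_def)
  moreover have "cdim (range (x \<otimes> y)) = 1"
  proof -
    have "x \<noteq> 0" using assms(1) by auto
    then have "complex_vector.independent {x}" by simp
    then show ?thesis
      using complex_vector.dim_eq_card_independent[of "{x}"]
      by (simp add: range_outer[OF assms(2)])
  qed
  ultimately show ?thesis
    using outer_bounded unfolding PI1_def partial_isometry_def by blast
qed

text \<open>The initial space of a partial isometry with one-dimensional range embeds isometrically
  into that range, so it is spanned by one unit vector \<open>w\<close>; and then \<open>U z = U (\<langle>z,w\<rangle> w)\<close>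
  because \<open>z - \<langle>z,w\<rangle> w\<close> is annihilated.\<close>
lemma PI1_outer:
  assumes "U \<in> PI1"
  obtains x y where "norm x = 1" "norm y = 1" "U = x \<otimes> y"
proof -
  obtain I where I: "csubspace I" "\<And>x. x \<in> I \<Longrightarrow> norm (U x) = norm x"
    "\<And>x. x \<in> ortho_complement I \<Longrightarrow> U x = 0"
    and lin: "clinear U" and dim: "cdim (range U) = 1"
    using assms unfolding PI1_def partial_isometry_def bounded_operators_def by auto
  interpret U: Vector_Spaces.linear scaleC scaleC U by (rule lin)
  obtain Bs where Bs: "Bs \<subseteq> range U" "complex_vector.independent Bs"
    "range U \<subseteq> cspan Bs" "card Bs = cdim (range U)"
    using complex_vector.basis_exists[of "range U"] .
  then obtain b where b: "Bs = {b}" using dim card_1_singletonE by metis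
  have "b \<noteq> 0" using Bs(2) b by auto
  then obtain z0 where "U z0 \<noteq> 0" using Bs(1) b by auto
  then have "z0 \<notin> ortho_complement I" using I(3) by blast
  then obtain w0 where w0: "w0 \<in> I" "w0 \<noteq> 0" unfolding ortho_complement_def by force
  define w where "w = complex_of_real (inverse (norm w0)) *\<^sub>C w0"
  have w: "norm w = 1" "w \<in> I"
    unfolding w_def using w0 normalize_unit complex_vector.subspace_scale[OF I(1)] by blast+
  obtain \<beta> where \<beta>: "U w = \<beta> *\<^sub>C b"
    using Bs(3) b by (auto simp: complex_vector.span_singleton)
  have "U w \<noteq> 0" using I(2)[OF w(2)] w(1) by auto
  then have "\<beta> \<noteq> 0" using \<beta> by auto
  have I_line: "\<exists>c. z = c *\<^sub>C w" if "z \<in> I" for z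
  proof -
    obtain \<alpha> where \<alpha>: "U z = \<alpha> *\<^sub>C b"
      using Bs(3) b by (auto simp: complex_vector.span_singleton)
    have "z - (\<alpha> / \<beta>) *\<^sub>C w \<in> I"
      using I(1) that w(2) complex_vector.subspace_diff complex_vector.subspace_scale by blast
    moreover have "U (z - (\<alpha> / \<beta>) *\<^sub>C w) = 0"
      using \<open>\<beta> \<noteq> 0\<close> by (simp add: U.diff U.scale \<alpha> \<beta>)
    ultimately have "z - (\<alpha> / \<beta>) *\<^sub>C w = 0" using I(2) by fastforce
    then show ?thesis by auto
  qed
  have "U z = (U w \<otimes> w) z" for z
  proof -
    have "z - cinner z w *\<^sub>C w \<in> ortho_complement I"
      using orthogonal_part_cinner[OF w(1), of z]
      by (auto simp: ortho_complement_def cinner_scaleC_right dest!: I_line)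
    then have "U (z - cinner z w *\<^sub>C w) = 0" by (rule I(3))
    then show ?thesis by (simp add: U.diff U.scale outer_def)
  qed
  then have "U = U w \<otimes> w" by (rule ext)
  then show thesis using that w(1) I(2)[OF w(2)] by metis
qed

lemma cadjoint_outer: "cadjoint (x \<otimes> y) = y \<otimes> x"
  unfolding cadjoint_def
proof (rule the_equality)
  show adj: "\<forall>z w. cinner ((x \<otimes> y) z) w = cinner z ((y \<otimes> x) w)"
    by (auto simp: outer_def cinner_simps cinner_commute[symmetric])
  fix S assume S: "\<forall>z w. cinner ((x \<otimes> y) z) w = cinner z (S w)"
  have "cinner (S w - (y \<otimes> x) w) (S w - (y \<otimes> x) w) = 0" for w
    using S adj by (metis cinner_diff_right diff_self)
  then show "S = y \<otimes> x" by (auto simp: cinner_eq_zero_iff)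
qed

text \<open>The Hilbert-Schmidt inner product, conjugate-linear in its first argument.\<close>
abbreviation hs :: "('a::complex_inner \<Rightarrow> 'a) \<Rightarrow> ('a \<Rightarrow> 'a) \<Rightarrow> complex" where
  "hs P Q \<equiv> tr (cadjoint P \<circ> Q)"

text \<open>Evaluated in an orthonormal basis, the trace is the Parseval expansion of \<open>\<langle>y,v\<rangle>\<close> times the
  constant \<open>\<langle>u,x\<rangle>\<close>. The factorization is the source of all geometry below: \<open>x \<otimes> y\<close> and \<open>u \<otimes> v\<close>
  are orthogonal exactly if \<open>x \<bottom> u\<close> or \<open>y \<bottom> v\<close>.\<close>
lemma hs_outer:
  assumes "separable_space (euclidean :: 'a::complex_inner topology)"
  shows "hs (x \<otimes> y) (u \<otimes> v) = cinner u x * cinner y (v :: 'a)"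
proof -
  define B where "B = (SOME B :: 'a set. orthonormal_basis B)"
  have B: "orthonormal_basis B"
    unfolding B_def using someI_ex[OF orthonormal_basis_exists[OF assms]] .
  have "((\<lambda>e. cinner u x * (cinner y e * cinner e v)) has_sum cinner u x * cinner y v) B"
    by (rule has_sum_cmult_right[OF Parseval[OF B]])
  then have "((\<lambda>e. cinner ((cadjoint (x \<otimes> y) \<circ> u \<otimes> v) e) e) has_sum cinner u x * cinner y v) B"
    by (simp add: cadjoint_outer) (simp add: outer_def cinner_simps mult_ac)
  then show ?thesis
    unfolding tr_def B_def[symmetric] by (rule infsumI)
qed

lemma outer_scaleC_right: "x \<otimes> (a *\<^sub>C y) = (cnj a *\<^sub>C x) \<otimes> y"
  by (simp add: outer_def cinner_simps mult.commute)

lemma range_outer_eq_iff: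
  assumes "norm x = 1" "norm y = 1" "norm u = 1" "norm v = 1"
  shows "range (x \<otimes> y) = range (u \<otimes> v) \<longleftrightarrow> cmod (cinner x u) = 1"
proof
  assume "range (x \<otimes> y) = range (u \<otimes> v)"
  then have "x \<in> cspan {u}"
    using complex_vector.span_base[of x "{x}"] assms by (simp add: range_outer)
  then obtain c where c: "x = c *\<^sub>C u" by (auto simp: complex_vector.span_singleton)
  then have "cmod c = 1" using assms by (simp add: norm_scaleC)
  then show "cmod (cinner x u) = 1"
    using c assms(3) by (simp add: cinner_simps cinner_self_unit)
next
  have *: "cspan {x} \<subseteq> cspan {u}" if "norm x = 1" "norm u = 1" "cmod (cinner x u) = 1" for x u :: 'a
  proof -
    have "x \<in> cspan {u}"
      using unit_aligned[OF that] by (metis complex_vector.span_base complex_vector.span_scale singletonI)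
    then show ?thesis
      by (simp add: complex_vector.span_minimal)
  qed
  assume "cmod (cinner x u) = 1"
  then show "range (x \<otimes> y) = range (u \<otimes> v)"
    using *[of x u] *[of u x] assms cmod_cinner_commute[of x u] by (simp add: range_outer)
qed

abbreviation kernel :: "('a::complex_inner \<Rightarrow> 'a) \<Rightarrow> 'a set" where
  "kernel T \<equiv> {z. T z = 0}"

lemma kernel_outer_eq_iff:
  assumes "norm x = 1" "norm y = 1" "norm u = 1" "norm v = 1"
  shows "kernel (x \<otimes> y) = kernel (u \<otimes> v) \<longleftrightarrow> cmod (cinner y v) = 1"
proof -
  have ker: "z \<in> kernel (x \<otimes> y) \<longleftrightarrow> cinner z y = 0" "z \<in> kernel (u \<otimes> v) \<longleftrightarrow> cinner z v = 0" for z
    using assms(1,3) by (auto simp: outer_def)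
  show ?thesis
  proof
    assume eq: "kernel (x \<otimes> y) = kernel (u \<otimes> v)"
    show "cmod (cinner y v) = 1"
    proof (rule ccontr)
      assume "cmod (cinner y v) \<noteq> 1"
      from separating_orthogonal_unit[OF assms(4,2) this]
      obtain a where "cinner a v = 0" "cinner a y \<noteq> 0" by metis
      then show False using eq ker by blast
    qed
  next
    assume 1: "cmod (cinner y v) = 1"
    then have "y = cinner y v *\<^sub>C v" by (rule unit_aligned[OF assms(2,4)])
    then have "cinner z y = cnj (cinner y v) * cinner z v" for z
      by (metis cinner_scaleC_right)
    moreover have "cinner y v \<noteq> 0" using 1 by auto
    ultimately show "kernel (x \<otimes> y) = kernel (u \<otimes> v)"
      using ker by (auto simp del: mem_Collect_eq)
  qed
qed

section \<open>Adjacency in terms of the trace form\<close>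

lemma unit_multiple_aligned:
  assumes "norm x = 1" "norm u = 1" "x = d *\<^sub>C u"
  shows "cmod (cinner x u) = 1"
proof -
  have "cmod d = 1" using assms by (metis norm_scaleC mult.right_neutral)
  then show ?thesis using assms(2) by (simp add: assms(3) cinner_simps cinner_self_unit)
qed

lemma aligned_trans:
  assumes "norm r = 1" "norm x = 1" "cmod (cinner r x) = 1" "cmod (cinner r u) = 1"
  shows "cmod (cinner x u) = 1"
proof -
  have "cinner r u = cinner r x * cinner x u"
    using unit_aligned[OF assms(1,2,3)] by (metis cinner_scaleC_left)
  then show ?thesis using assms(3,4) by (simp add: norm_mult)
qed

lemma aligned_orthogonal_iff:
  assumes "norm x = 1" "norm u = 1" "cmod (cinner x u) = 1"
  shows "cinner a x = 0 \<longleftrightarrow> cinner a u = 0"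
proof -
  have "cinner a x = cnj (cinner x u) * cinner a u"
    using unit_aligned[OF assms] by (metis cinner_scaleC_right)
  then show ?thesis using assms(3) by auto
qed

text \<open>A normalized \<open>y + v\<close> lies in the span of \<open>y\<close> and \<open>v\<close> but on neither of the two lines.\<close>
lemma third_unit_vector:
  assumes "norm y = 1" "norm v = 1" "cmod (cinner y v) \<noteq> 1"
  obtains s where "norm s = 1" "cmod (cinner s y) \<noteq> 1" "cmod (cinner s v) \<noteq> 1"
    "\<And>b. cinner y b = 0 \<Longrightarrow> cinner v b = 0 \<Longrightarrow> cinner s b = 0"
proof -
  have key: "y + v \<noteq> k *\<^sub>C y" if "norm y = 1" "norm v = 1" "cmod (cinner y v) \<noteq> 1" for k and y v :: 'a
  proof
    assume "y + v = k *\<^sub>C y"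
    then have "v = (k - 1) *\<^sub>C y"
      by (simp add: algebra_simps)
    then have "cmod (cinner v y) = 1" using unit_multiple_aligned that by blast
    then show False using that(3) by (simp add: cmod_cinner_commute)
  qed
  have "y + v \<noteq> 0" using key[OF assms, of 0] by simp
  define c where "c = complex_of_real (inverse (norm (y + v)))"
  define s where "s = c *\<^sub>C (y + v)"
  have c0: "c \<noteq> 0" using \<open>y + v \<noteq> 0\<close> by (simp add: c_def)
  have s: "norm s = 1" unfolding s_def c_def by (rule normalize_unit[OF \<open>y + v \<noteq> 0\<close>])
  have inv: "y + v = (k / c) *\<^sub>C z" if "s = k *\<^sub>C z" for k z
  proof -
    have "y + v = inverse c *\<^sub>C s" using c0 by (simp add: s_def)
    then show ?thesis using that by (simp add: field_simps)
  qed
  have "cmod (cinner s y) \<noteq> 1"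
    using inv[OF unit_aligned[OF s assms(1)]] key[OF assms] by blast
  moreover have "cmod (cinner s v) \<noteq> 1"
    using inv[OF unit_aligned[OF s assms(2)]] key[of v y] assms
    by (metis add.commute cmod_cinner_commute)
  ultimately show thesis
    using that[OF s] by (simp add: s_def cinner_simps)
qed

text \<open>If \<open>r\<close> were off the line of \<open>x\<close> and \<open>s\<close> off the line of \<open>v\<close>, each would have a separating vector,
  \<open>a\<close> and \<open>b\<close>, and that pair would refute the assumption.\<close>
lemma aligned_dichotomy:
  assumes "norm x = 1" "norm v = 1" "norm r = 1" "norm s = 1"
    and "\<And>a b. norm a = 1 \<Longrightarrow> norm b = 1 \<Longrightarrow> cinner a x = 0 \<Longrightarrow> cinner b v = 0 \<Longrightarrow>
      cinner a r = 0 \<or> cinner b s = 0"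
  shows "cmod (cinner r x) = 1 \<or> cmod (cinner s v) = 1"
  using assms(5) separating_orthogonal_unit[OF assms(1,3)] separating_orthogonal_unit[OF assms(2,4)]
  by metis

lemma cmod_mult_eq_1_iff:
  assumes "cmod z \<le> 1" "cmod w \<le> 1"
  shows "cmod (z * w) = 1 \<longleftrightarrow> cmod z = 1 \<and> cmod w = 1"
proof
  assume 1: "cmod (z * w) = 1"
  have "cmod z * cmod w \<le> cmod z" "cmod z * cmod w \<le> cmod w"
    using assms by (simp_all add: mult_left_le mult_left_le_one_le)
  then show "cmod z = 1 \<and> cmod w = 1" using 1 assms by (simp add: norm_mult)
qed (simp add: norm_mult)

text \<open>Both factors of the form have modulus at most 1, so the product has modulus 1 only if both do.
  Hence modulus 1 means that the two operators agree up to a phase.\<close>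
lemma cmod_hs_eq_1_iff:
  assumes "separable_space (euclidean :: 'a::complex_inner topology)"
    and "norm x = 1" "norm y = 1" "norm u = 1" "norm (v::'a) = 1"
  shows "cmod (hs (x \<otimes> y) (u \<otimes> v)) = 1 \<longleftrightarrow> cmod (cinner x u) = 1 \<and> cmod (cinner y v) = 1"
  using cmod_mult_eq_1_iff[of "cinner u x" "cinner y v"] norm_cinner_le[of u x] norm_cinner_le[of y v]
    assms by (simp add: hs_outer cmod_cinner_commute)

text \<open>Adjacency (equal ranges or equal kernels) is visible to the form alone. Two operators in one row
  \<open>x \<otimes> y\<close>, \<open>x \<otimes> v\<close> that are not proportional admit a third one, \<open>x \<otimes> s\<close> with \<open>s\<close> in the span of
  \<open>y\<close> and \<open>v\<close>, that is orthogonal to whatever is orthogonal to both. If neither range nor kernel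
  agree, then such a third operator \<open>r \<otimes> s\<close> must be proportional to one of the two: testing with
  \<open>a \<otimes> b\<close> for \<open>a \<bottom> x\<close>, \<open>b \<bottom> v\<close> forces \<open>r\<close> onto the line of \<open>x\<close> or \<open>s\<close> onto that of \<open>v\<close>, and
  testing with \<open>a \<bottom> u\<close>, \<open>b \<bottom> y\<close> forces \<open>r\<close> onto the line of \<open>u\<close> or \<open>s\<close> onto that of \<open>y\<close>.\<close>
lemma adjacent_iff:
  fixes P Q :: "'a::complex_inner \<Rightarrow> 'a"
  assumes sep: "separable_space (euclidean :: 'a topology)"
    and "P \<in> PI1" "Q \<in> PI1"
  shows "range P = range Q \<or> kernel P = kernel Q \<longleftrightarrow>
    cmod (hs P Q) = 1 \<or>
    (\<exists>R\<in>PI1. cmod (hs P R) \<noteq> 1 \<and> cmod (hs Q R) \<noteq> 1 \<and>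
      (\<forall>T\<in>PI1. hs P T = 0 \<and> hs Q T = 0 \<longrightarrow> hs R T = 0))"
    (is "?adj \<longleftrightarrow> ?par \<or> (\<exists>R\<in>PI1. ?third R)")
proof -
  obtain x y where P: "norm x = 1" "norm y = 1" "P = x \<otimes> y" using PI1_outer[OF assms(2)] .
  obtain u v where Q: "norm u = 1" "norm v = 1" "Q = u \<otimes> v" using PI1_outer[OF assms(3)] .
  have adj: "?adj \<longleftrightarrow> cmod (cinner x u) = 1 \<or> cmod (cinner y v) = 1"
    using range_outer_eq_iff kernel_outer_eq_iff P Q by metis
  have par: "?par \<longleftrightarrow> cmod (cinner x u) = 1 \<and> cmod (cinner y v) = 1"
    using P Q cmod_hs_eq_1_iff[OF sep] by metis
  have third: "?third (r \<otimes> s) \<longleftrightarrow>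
      \<not> (cmod (cinner x r) = 1 \<and> cmod (cinner y s) = 1) \<and>
      \<not> (cmod (cinner u r) = 1 \<and> cmod (cinner v s) = 1) \<and>
      (\<forall>a b. norm a = 1 \<longrightarrow> norm b = 1 \<longrightarrow> (cinner a x = 0 \<or> cinner y b = 0) \<longrightarrow>
        (cinner a u = 0 \<or> cinner v b = 0) \<longrightarrow> (cinner a r = 0 \<or> cinner s b = 0))"
    if "norm r = 1" "norm s = 1" for r s
  proof -
    have T: "(\<forall>T\<in>PI1. hs P T = 0 \<and> hs Q T = 0 \<longrightarrow> hs (r \<otimes> s) T = 0) \<longleftrightarrow>
      (\<forall>a b. norm a = 1 \<longrightarrow> norm b = 1 \<longrightarrow> hs P (a \<otimes> b) = 0 \<and> hs Q (a \<otimes> b) = 0 \<longrightarrow>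
        hs (r \<otimes> s) (a \<otimes> b) = 0)"
      using outer_in_PI1 PI1_outer by metis
    have par_R: "cmod (hs P (r \<otimes> s)) = 1 \<longleftrightarrow> cmod (cinner x r) = 1 \<and> cmod (cinner y s) = 1"
      "cmod (hs Q (r \<otimes> s)) = 1 \<longleftrightarrow> cmod (cinner u r) = 1 \<and> cmod (cinner v s) = 1"
      using cmod_hs_eq_1_iff[OF sep] P Q that by metis+
    show ?thesis
      unfolding par_R T unfolding P(3) Q(3) hs_outer[OF sep] mult_eq_0_iff by blast
  qed
  show ?thesis
  proof
    assume ?adj
    show "?par \<or> (\<exists>R\<in>PI1. ?third R)"
    proof (cases ?par)
      case False
      consider (range) "cmod (cinner x u) = 1" "cmod (cinner y v) \<noteq> 1"
        | (ker) "cmod (cinner x u) \<noteq> 1" "cmod (cinner y v) = 1"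
        using \<open>?adj\<close> False adj par by blast
      then show ?thesis
      proof cases
        case range
        obtain s where s: "norm s = 1" "cmod (cinner s y) \<noteq> 1" "cmod (cinner s v) \<noteq> 1"
          "\<And>b. cinner y b = 0 \<Longrightarrow> cinner v b = 0 \<Longrightarrow> cinner s b = 0"
          using third_unit_vector[OF P(2) Q(2) range(2)] by blast
        have "?third (x \<otimes> s)"
          unfolding third[OF P(1) s(1)]
          using s aligned_orthogonal_iff[OF P(1) Q(1) range(1)] by (metis cmod_cinner_commute)
        then show ?thesis using outer_in_PI1[OF P(1) s(1)] by blast
      next
        case ker
        obtain r where r: "norm r = 1" "cmod (cinner r x) \<noteq> 1" "cmod (cinner r u) \<noteq> 1"
          "\<And>b. cinner x b = 0 \<Longrightarrow> cinner u b = 0 \<Longrightarrow> cinner r b = 0"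
          using third_unit_vector[OF P(1) Q(1) ker(1)] by blast
        have "?third (r \<otimes> y)"
          unfolding third[OF r(1) P(2)]
          using r aligned_orthogonal_iff[OF P(2) Q(2) ker(2)]
          by (metis cmod_cinner_commute cinner_swap_zero)
        then show ?thesis using outer_in_PI1[OF r(1) P(2)] by blast
      qed
    qed simp
  next
    assume "?par \<or> (\<exists>R\<in>PI1. ?third R)"
    then show ?adj
    proof
      assume "\<exists>R\<in>PI1. ?third R"
      then obtain R where R: "R \<in> PI1" "?third R" by blast
      obtain r s where rs: "norm r = 1" "norm s = 1" "R = r \<otimes> s" using PI1_outer[OF R(1)] .
      note R3 = R(2)[unfolded rs(3) third[OF rs(1,2)]]
      have "cmod (cinner r x) = 1 \<or> cmod (cinner s v) = 1"
        by (rule aligned_dichotomy[OF P(1) Q(2) rs(1,2)]) (metis R3 cinner_swap_zero)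
      moreover have "cmod (cinner r u) = 1 \<or> cmod (cinner s y) = 1"
        by (rule aligned_dichotomy[OF Q(1) P(2) rs(1,2)]) (metis R3 cinner_swap_zero)
      ultimately have "cmod (cinner r x) = 1 \<and> cmod (cinner r u) = 1 \<or>
          cmod (cinner s y) = 1 \<and> cmod (cinner s v) = 1"
        using R3 by (metis cmod_cinner_commute)
      then show ?adj
        unfolding adj using aligned_trans P Q rs by metis
    qed (use adj par in blast)
  qed
qed

section \<open>Rows and columns\<close>

text \<open>Adjacency of grid points is a rook's move; \<open>r\<close> and \<open>k\<close> are the row and column coordinates. Every
  line is mapped into a line, the row and the column through a point get lines of different kinds,
  and so the kind is the same everywhere. The two points \<open>A\<close> and \<open>B\<close> exclude a grid with a single
  row or a single column and several points, where the claim fails.\<close>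
lemma rook_map:
  assumes adj: "\<And>P Q. P \<in> S \<Longrightarrow> Q \<in> S \<Longrightarrow>
      r (f P) = r (f Q) \<or> k (f P) = k (f Q) \<longleftrightarrow> r P = r Q \<or> k P = k Q"
    and grid: "\<And>P Q. P \<in> S \<Longrightarrow> Q \<in> S \<Longrightarrow> \<exists>M\<in>S. r M = r P \<and> k M = k Q"
    and AB: "A \<in> S" "B \<in> S" "r A \<noteq> r B" "k A \<noteq> k B"
  shows "(\<forall>P\<in>S. \<forall>Q\<in>S. (r P = r Q \<longrightarrow> r (f P) = r (f Q)) \<and> (k P = k Q \<longrightarrow> k (f P) = k (f Q))) \<or>
    (\<forall>P\<in>S. \<forall>Q\<in>S. (r P = r Q \<longrightarrow> k (f P) = k (f Q)) \<and> (k P = k Q \<longrightarrow> r (f P) = r (f Q)))"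
proof -
  define rr where "rr P \<longleftrightarrow> (\<forall>Q\<in>S. r P = r Q \<longrightarrow> r (f P) = r (f Q))" for P
  define rk where "rk P \<longleftrightarrow> (\<forall>Q\<in>S. r P = r Q \<longrightarrow> k (f P) = k (f Q))" for P
  define kr where "kr P \<longleftrightarrow> (\<forall>Q\<in>S. k P = k Q \<longrightarrow> r (f P) = r (f Q))" for P
  define kk where "kk P \<longleftrightarrow> (\<forall>Q\<in>S. k P = k Q \<longrightarrow> k (f P) = k (f Q))" for P
  \<comment> \<open>Pairwise adjacent points lie in one row or in one column.\<close>
  have row: "rr P \<or> rk P" if "P \<in> S" for P
    unfolding rr_def rk_def using adj that by metis
  have col: "kr P \<or> kk P" if "P \<in> S" for P
    unfolding kr_def kk_def using adj that by metis
  \<comment> \<open>Otherwise the row and the column through \<open>P\<close> are mapped into a single line, although some of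
    their points are not adjacent to each other.\<close>
  have opposite: "\<not> (rr P \<and> kr P)" "\<not> (rk P \<and> kk P)" if P: "P \<in> S" for P
  proof -
    obtain M where M: "M \<in> S" "r M = r P" "k M \<noteq> k P"
      using grid[OF P AB(1)] grid[OF P AB(2)] AB(4) by metis
    obtain N where N: "N \<in> S" "k N = k P" "r N \<noteq> r P"
      using grid[OF AB(1) P] grid[OF AB(2) P] AB(3) by metis
    have "\<not> (r (f M) = r (f N) \<or> k (f M) = k (f N))"
      using adj[OF M(1) N(1)] M N by metis
    then show "\<not> (rr P \<and> kr P)" "\<not> (rk P \<and> kk P)"
      unfolding rr_def rk_def kr_def kk_def using M N by metis+
  qed
  have row_const: "rr P \<Longrightarrow> rr Q" if "P \<in> S" "Q \<in> S" "r P = r Q" for P Q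
    unfolding rr_def using that by metis
  have col_const: "kk P \<Longrightarrow> kk Q" if "P \<in> S" "Q \<in> S" "k P = k Q" for P Q
    unfolding kk_def using that by metis
  have type: "rr P \<longleftrightarrow> kk P" if "P \<in> S" for P
    using row col opposite that by blast
  have const: "rr P \<longleftrightarrow> rr Q" if "P \<in> S" "Q \<in> S" for P Q
    using grid[OF that] row_const col_const type that by metis
  show ?thesis
  proof (cases "rr A")
    case True
    then have "rr P \<and> kk P" if "P \<in> S" for P using const type that AB(1) by blast
    then show ?thesis unfolding rr_def kk_def by blast
  next
    case False
    then have "rk P \<and> kr P" if "P \<in> S" for P using const type row col that AB(1) by blast
    then show ?thesis unfolding rk_def kr_def by blast
  qed
qed

text \<open>Adjacency is expressed through the form and quantifiers over \<open>PI1\<close>, so the bijection preserves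
  and reflects it. Without two non-adjacent operators the space has dimension at most one; then all
  ranges agree and all kernels agree, and there is nothing to prove.\<close>
lemma range_kernel_preserved_or_swapped:
  fixes \<phi> :: "('a::complex_inner \<Rightarrow> 'a) \<Rightarrow> ('a \<Rightarrow> 'a)"
  assumes sep: "separable_space (euclidean :: 'a topology)"
    and bij: "bij_betw \<phi> PI1 PI1"
    and hs: "\<And>P Q. P \<in> PI1 \<Longrightarrow> Q \<in> PI1 \<Longrightarrow> hs (\<phi> P) (\<phi> Q) = hs P Q"
  shows "(\<forall>P\<in>PI1. \<forall>Q\<in>PI1. (range P = range Q \<longrightarrow> range (\<phi> P) = range (\<phi> Q)) \<and>
       (kernel P = kernel Q \<longrightarrow> kernel (\<phi> P) = kernel (\<phi> Q))) \<or>
    (\<forall>P\<in>PI1. \<forall>Q\<in>PI1. (range P = range Q \<longrightarrow> kernel (\<phi> P) = kernel (\<phi> Q)) \<and>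
       (kernel P = kernel Q \<longrightarrow> range (\<phi> P) = range (\<phi> Q)))"
proof (cases "\<exists>A\<in>PI1. \<exists>B\<in>PI1. range A \<noteq> range B \<and> kernel A \<noteq> kernel (B :: 'a \<Rightarrow> 'a)")
  case True
  then obtain A B :: "'a \<Rightarrow> 'a" where AB: "A \<in> PI1" "B \<in> PI1" "range A \<noteq> range B" "kernel A \<noteq> kernel B"
    by blast
  have im: "\<phi> ` PI1 = PI1" using bij by (simp add: bij_betw_def)
  have \<phi>: "\<phi> P \<in> PI1" if "P \<in> PI1" for P using im that by blast
  have adj: "range (\<phi> P) = range (\<phi> Q) \<or> kernel (\<phi> P) = kernel (\<phi> Q) \<longleftrightarrow>
      range P = range Q \<or> kernel P = kernel Q" if PQ: "P \<in> PI1" "Q \<in> PI1" for P Q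
  proof -
    let ?third = "\<lambda>P Q R. cmod (hs P R) \<noteq> 1 \<and> cmod (hs Q R) \<noteq> 1 \<and>
      (\<forall>T\<in>PI1. hs P T = 0 \<and> hs Q T = 0 \<longrightarrow> hs R T = 0)"
    have "?third (\<phi> P) (\<phi> Q) (\<phi> R) \<longleftrightarrow> ?third P Q R" if R: "R \<in> PI1" for R
    proof -
      have "(\<forall>T\<in>\<phi> ` PI1. hs (\<phi> P) T = 0 \<and> hs (\<phi> Q) T = 0 \<longrightarrow> hs (\<phi> R) T = 0) \<longleftrightarrow>
        (\<forall>T\<in>PI1. hs P T = 0 \<and> hs Q T = 0 \<longrightarrow> hs R T = 0)"
        using PQ R by (simp add: hs)
      then show ?thesis using PQ R by (simp add: hs im)
    qed
    then have "(\<exists>R\<in>\<phi> ` PI1. ?third (\<phi> P) (\<phi> Q) R) \<longleftrightarrow> (\<exists>R\<in>PI1. ?third P Q R)"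
      by (simp del: o_apply)
    then have "(\<exists>R\<in>PI1. ?third (\<phi> P) (\<phi> Q) R) \<longleftrightarrow> (\<exists>R\<in>PI1. ?third P Q R)"
      by (simp only: im)
    then show ?thesis
      using PQ \<phi> by (simp only: adjacent_iff[OF sep] hs)
  qed
  have grid: "\<exists>M\<in>PI1. range M = range P \<and> kernel M = kernel Q"
    if PQ: "P \<in> PI1" "Q \<in> PI1" for P Q :: "'a \<Rightarrow> 'a"
  proof -
    obtain x y where P: "norm x = 1" "norm y = 1" "P = x \<otimes> y" using PI1_outer[OF PQ(1)] .
    obtain u v where Q: "norm u = 1" "norm v = 1" "Q = u \<otimes> v" using PI1_outer[OF PQ(2)] .
    have "range (x \<otimes> v) = range P" "kernel (x \<otimes> v) = kernel Q"
      using range_outer_eq_iff[OF P(1) Q(2) P(1,2)] kernel_outer_eq_iff[OF P(1) Q(2) Q(1,2)] P Q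
      by (simp_all add: cinner_self_unit)
    then show ?thesis using outer_in_PI1[OF P(1) Q(2)] by blast
  qed
  show ?thesis
    by (rule rook_map[where r = range and k = kernel, OF adj grid AB])
next
  case False
  have aligned: "cmod (cinner x u) = 1" if "norm x = 1" "norm u = 1" for x u :: 'a
    using False outer_in_PI1[OF that(1,1)] outer_in_PI1[OF that(2,2)]
      range_outer_eq_iff[of x x u u] kernel_outer_eq_iff[of x x u u] that by metis
  have "range P = range Q \<and> kernel P = kernel Q"
    if PQ: "P \<in> PI1" "Q \<in> PI1" for P Q :: "'a \<Rightarrow> 'a"
  proof -
    obtain x y where P: "norm x = 1" "norm y = 1" "P = x \<otimes> y" using PI1_outer[OF PQ(1)] .
    obtain u v where Q: "norm u = 1" "norm v = 1" "Q = u \<otimes> v" using PI1_outer[OF PQ(2)] .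
    show ?thesis
      unfolding P(3) Q(3) range_outer_eq_iff[OF P(1,2) Q(1,2)] kernel_outer_eq_iff[OF P(1,2) Q(1,2)]
      using aligned P Q by blast
  qed
  moreover have "\<phi> P \<in> PI1" if "P \<in> PI1" for P
    using bij that by (auto simp: bij_betw_def)
  ultimately show ?thesis by blast
qed

section \<open>From the unit sphere to unitaries and antiunitaries\<close>

lemma eq_if_cinner_eq:
  assumes "\<And>z. cinner x z = cinner y z"
  shows "x = y"
proof -
  have "cinner (x - y) (x - y) = 0" using assms by (simp add: cinner_diff_left)
  then show ?thesis by (simp add: cinner_eq_zero_iff)
qed

text \<open>The case \<open>c = id\<close> leads to unitaries and \<open>c = cnj\<close> to antiunitaries. The extension is homogeneous
  for positive reals by construction, and its linearity or antilinearity follows from the inner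
  product identity and surjectivity (see the next lemma).\<close>
lemma sphere_map_extends:
  fixes U :: "'a::complex_inner \<Rightarrow> 'a"
  assumes c: "c = id \<or> c = cnj"
    and inner: "\<And>x y. norm x = 1 \<Longrightarrow> norm y = 1 \<Longrightarrow> cinner (U x) (U y) = c (cinner x y)"
    and surj: "\<And>w. norm w = 1 \<Longrightarrow> \<exists>x. norm x = 1 \<and> U x = w"
  obtains U' where "\<And>x. norm x = 1 \<Longrightarrow> U' x = U x" "bij U'"
    "\<And>x y. cinner (U' x) (U' y) = c (cinner x y)"
proof -
  define n where "n x = complex_of_real (inverse (norm x)) *\<^sub>C x" for x :: 'a
  define U' where "U' x = complex_of_real (norm x) *\<^sub>C U (n x)" for x
  have c_mult: "c (a * b) = c a * c b" and c_real: "c (complex_of_real t) = complex_of_real t"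
    and c_inj: "c a = c b \<Longrightarrow> a = b" for a b t
    using c by auto
  have ext: "U' x = U x" if "norm x = 1" for x
    using that by (simp add: U'_def n_def)
  have U'_inner: "cinner (U' x) (U' y) = c (cinner x y)" for x y
  proof (cases "x = 0 \<or> y = 0")
    case True
    then show ?thesis using c by (auto simp: U'_def)
  next
    case False
    then have "norm (n x) = 1" "norm (n y) = 1" unfolding n_def using normalize_unit by blast+
    then have "cinner (U' x) (U' y) = complex_of_real (norm x * norm y) * c (cinner (n x) (n y))"
      by (simp add: U'_def cinner_simps inner)
    also have "\<dots> = c (cinner (complex_of_real (norm x) *\<^sub>C n x) (complex_of_real (norm y) *\<^sub>C n y))"
      by (simp add: cinner_simps c_mult c_real)
    finally show ?thesis by (simp only: n_def scaleC_norm_normalize)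
  qed
  have "inj U'"
  proof (rule injI)
    fix x y assume "U' x = U' y"
    then have "c (cinner x z) = c (cinner y z)" for z using U'_inner by metis
    then show "x = y" using c_inj eq_if_cinner_eq by metis
  qed
  moreover have "\<exists>x. w = U' x" for w
  proof (cases "w = 0")
    case True
    then have "w = U' 0" by (simp add: U'_def)
    then show ?thesis ..
  next
    case False
    then have "norm (n w) = 1" unfolding n_def by (rule normalize_unit)
    then obtain x where x: "norm x = 1" "U x = n w" using surj by blast
    have "n (complex_of_real (norm w) *\<^sub>C x) = x"
      using x(1) False by (simp add: n_def norm_scaleC)
    then have "U' (complex_of_real (norm w) *\<^sub>C x) = complex_of_real (norm w) *\<^sub>C n w"
      using x by (simp add: U'_def norm_scaleC)
    then show ?thesis by (metis n_def scaleC_norm_normalize)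
  qed
  ultimately have "bij U'" unfolding bij_def surj_def by blast
  then show thesis using that ext U'_inner by blast
qed

text \<open>By surjectivity a vector is determined by its inner products with the values \<open>U z\<close>, so each
  linearity equation for \<open>U\<close> can be tested against them, where it reduces to one for \<open>cinner\<close>.\<close>
lemma
  fixes U :: "'a::complex_inner \<Rightarrow> 'a"
  assumes bij: "bij U"
  shows unitary_if_cinner: "(\<And>x y. cinner (U x) (U y) = cinner x y) \<Longrightarrow> unitary U"
    and antiunitary_if_cinner: "(\<And>x y. cinner (U x) (U y) = cnj (cinner x y)) \<Longrightarrow> antiunitary U"
proof -
  have norm: "norm (U x) = norm x"
    if "cinner (U x) (U x) = cinner x x \<or> cinner (U x) (U x) = cnj (cinner x x)" for x
    using that by (auto simp: norm_eq_sqrt_cinner)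
  have eqI: "a = b" if "\<And>z. cinner a (U z) = cinner b (U z)" for a b
    using that bij eq_if_cinner_eq by (metis bij_pointE)
  show "unitary U" if U: "\<And>x y. cinner (U x) (U y) = cinner x y"
  proof -
    have "clinear U"
      by (rule clinearI; rule eqI) (simp_all add: cinner_simps U)
    then show ?thesis using bij norm U by (simp add: unitary_def)
  qed
  show "antiunitary U" if U: "\<And>x y. cinner (U x) (U y) = cnj (cinner x y)"
  proof -
    have "U (x + y) = U x + U y" for x y
      by (rule eqI) (simp add: cinner_simps U)
    moreover have "U (a *\<^sub>C x) = cnj a *\<^sub>C U x" for a x
      by (rule eqI) (simp add: cinner_simps U)
    ultimately show ?thesis using bij norm U by (simp add: antiunitary_def antilinear_def)
  qed
qed

section \<open>Maps that preserve ranges and kernels\<close>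

lemma outer_cancel:
  assumes "norm a = 1"
  shows "x \<otimes> a = y \<otimes> a \<Longrightarrow> x = y" "a \<otimes> x = a \<otimes> y \<Longrightarrow> x = y"
proof -
  have left: "x \<otimes> a = y \<otimes> a \<Longrightarrow> x = y" for x y
    using assms by (metis cinner_self_unit outer_def scaleC_one)
  show "x \<otimes> a = y \<otimes> a \<Longrightarrow> x = y" by (rule left)
  show "a \<otimes> x = a \<otimes> y \<Longrightarrow> x = y" using left cadjoint_outer by metis
qed

lemma same_kernel_outer:
  assumes "T \<in> PI1" "norm a = 1" "norm b = 1" "kernel T = kernel (a \<otimes> b)"
  obtains u where "norm u = 1" "T = u \<otimes> b"
proof -
  obtain x y where T: "norm x = 1" "norm y = 1" "T = x \<otimes> y" using PI1_outer[OF assms(1)] .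
  have 1: "cmod (cinner y b) = 1" using kernel_outer_eq_iff[OF T(1,2) assms(2,3)] assms(4) T(3) by blast
  then have "T = (cnj (cinner y b) *\<^sub>C x) \<otimes> b"
    using unit_aligned[OF T(2) assms(3)] T(3) by (metis outer_scaleC_right)
  moreover have "norm (cnj (cinner y b) *\<^sub>C x) = 1" using T(1) 1 by (simp add: norm_scaleC)
  ultimately show thesis using that by blast
qed

lemma same_range_outer:
  assumes "T \<in> PI1" "norm a = 1" "norm b = 1" "range T = range (a \<otimes> b)"
  obtains v where "norm v = 1" "T = a \<otimes> v"
proof -
  obtain x y where T: "norm x = 1" "norm y = 1" "T = x \<otimes> y" using PI1_outer[OF assms(1)] .
  have 1: "cmod (cinner x a) = 1" using range_outer_eq_iff[OF T(1,2) assms(2,3)] assms(4) T(3) by blast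
  have "T = a \<otimes> (cnj (cinner x a) *\<^sub>C y)"
    using unit_aligned[OF T(1) assms(2) 1] T(3) by (metis outer_scaleC_right complex_cnj_cnj)
  moreover have "norm (cnj (cinner x a) *\<^sub>C y) = 1" using T(2) 1 by (simp add: norm_scaleC)
  ultimately show thesis using that by blast
qed

lemma connecting_unit_vector:
  assumes "norm x = 1" "norm e = 1"
  obtains u where "norm u = 1" "cinner x u \<noteq> 0" "cinner u e \<noteq> 0"
proof (cases "cinner x e = 0")
  case False
  then show thesis using that[of x] assms by (simp add: cinner_self_unit)
next
  case True
  define u where "u = complex_of_real (inverse (norm (x + e))) *\<^sub>C (x + e)"
  have xe: "cinner x (x + e) = 1" "cinner (x + e) e = 1"
    using True assms by (simp_all add: cinner_simps cinner_self_unit)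
  then have "x + e \<noteq> 0" by auto
  then show thesis
    using that[of u] normalize_unit[of "x + e"] xe
    by (simp add: u_def cinner_scaleC_left cinner_scaleC_right)
qed

text \<open>Phases agree along non-orthogonal pairs, and every pair \<open>(x, y)\<close> is joined to \<open>(e, e)\<close> through one
  intermediate pair.\<close>
lemma phase_rigidity:
  fixes p :: "'a::complex_inner \<Rightarrow> 'a \<Rightarrow> complex"
  assumes p: "\<And>x y u v. \<lbrakk>norm x = 1; norm y = 1; norm u = 1; norm v = 1;
      cinner x u \<noteq> 0; cinner y v \<noteq> 0\<rbrakk> \<Longrightarrow> cnj (p x y) * p u v = 1"
    and e: "norm e = 1" "p e e = 1"
    and xy: "norm x = 1" "norm y = 1"
  shows "p x y = 1"
proof -
  obtain u where u: "norm u = 1" "cinner x u \<noteq> 0" "cinner u e \<noteq> 0"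
    using connecting_unit_vector[OF xy(1) e(1)] .
  obtain v where v: "norm v = 1" "cinner y v \<noteq> 0" "cinner v e \<noteq> 0"
    using connecting_unit_vector[OF xy(2) e(1)] .
  have "cnj (p u v) = 1" using p[OF u(1) v(1) e(1,1) u(3) v(3)] e(2) by simp
  then have "p u v = 1" by simp
  then have "cnj (p x y) = 1" using p[OF xy u(1) v(1) u(2) v(2)] by simp
  then show ?thesis by simp
qed

text \<open>A unit vector on the line of \<open>F x\<close> is a phase times \<open>F x\<close>, and that phase can be moved into the
  argument of \<open>F\<close>, conjugated if \<open>c = cnj\<close>.\<close>
lemma aligned_with_image:
  assumes c: "c = id \<or> c = cnj"
    and F: "\<And>x y. norm x = 1 \<Longrightarrow> norm y = 1 \<Longrightarrow> cinner (F x) (F y) = c (cinner x y)"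
    and w: "norm w = 1" "norm x = 1" "cmod (cinner w (F x)) = 1"
  shows "\<exists>z. norm z = 1 \<and> F z = w"
proof -
  have nF: "norm (F z) = 1" if "norm z = 1" for z
  proof -
    have "cinner (F z) (F z) = 1"
      using F[OF that that] cinner_self_unit[OF that] c by auto
    then show ?thesis by (simp add: norm_eq_sqrt_cinner)
  qed
  define k where "k = c (cinner w (F x))"
  have ck: "c k = cinner w (F x)" using c by (auto simp: k_def)
  have "cmod k = 1" using c w(3) by (auto simp: k_def)
  then have kx: "norm (k *\<^sub>C x) = 1" using w(2) by (simp add: norm_scaleC)
  have Fk: "cinner (F (k *\<^sub>C x)) (F x) = cinner w (F x)"
    using F[OF kx w(2)] ck by (simp add: cinner_scaleC_left cinner_self_unit[OF w(2)])
  have "F (k *\<^sub>C x) = cinner (F (k *\<^sub>C x)) (F x) *\<^sub>C F x"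
    by (rule unit_aligned[OF nF[OF kx] nF[OF w(2)]]) (simp only: Fk w(3))
  also have "\<dots> = w"
    unfolding Fk by (rule unit_aligned[OF w(1) nF[OF w(2)] w(3), symmetric])
  finally show ?thesis using kx by blast
qed

section \<open>The adjoint on rank-one partial isometries\<close>

lemma cadjoint_in_PI1: "P \<in> PI1 \<Longrightarrow> cadjoint P \<in> PI1"
  using PI1_outer outer_in_PI1 cadjoint_outer by metis

lemma cadjoint_cadjoint_PI1: "P \<in> PI1 \<Longrightarrow> cadjoint (cadjoint P) = P"
  using PI1_outer cadjoint_outer by metis

lemma cadjoint_image_PI1: "cadjoint ` PI1 = PI1"
  using cadjoint_in_PI1 cadjoint_cadjoint_PI1 by (metis image_subsetI imageI subsetI subset_antisym)

lemma cadjoint_swaps_range_kernel: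
  assumes "P \<in> PI1" "Q \<in> PI1"
  shows range_cadjoint_eq_iff: "range (cadjoint P) = range (cadjoint Q) \<longleftrightarrow> kernel P = kernel Q"
    and kernel_cadjoint_eq_iff: "kernel (cadjoint P) = kernel (cadjoint Q) \<longleftrightarrow> range P = range Q"
proof -
  obtain x y where P: "norm x = 1" "norm y = 1" "P = x \<otimes> y" using PI1_outer[OF assms(1)] .
  obtain u v where Q: "norm u = 1" "norm v = 1" "Q = u \<otimes> v" using PI1_outer[OF assms(2)] .
  show "range (cadjoint P) = range (cadjoint Q) \<longleftrightarrow> kernel P = kernel Q"
    "kernel (cadjoint P) = kernel (cadjoint Q) \<longleftrightarrow> range P = range Q"
    unfolding P(3) Q(3) cadjoint_outer
    using range_outer_eq_iff[OF P(1,2) Q(1,2)] range_outer_eq_iff[OF P(2,1) Q(2,1)]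
      kernel_outer_eq_iff[OF P(1,2) Q(1,2)] kernel_outer_eq_iff[OF P(2,1) Q(2,1)] by blast+
qed

text \<open>The adjoint conjugates the form; this is why the second form of the theorem has antiunitaries.\<close>
lemma hs_cadjoint:
  assumes sep: "separable_space (euclidean :: 'a::complex_inner topology)"
    and "P \<in> PI1" "(Q :: 'a \<Rightarrow> 'a) \<in> PI1"
  shows "hs (cadjoint P) (cadjoint Q) = cnj (hs P Q)"
proof -
  obtain x y where P: "norm x = 1" "norm y = 1" "P = x \<otimes> y" using PI1_outer[OF assms(2)] .
  obtain u v where Q: "norm u = 1" "norm v = 1" "Q = u \<otimes> v" using PI1_outer[OF assms(3)] .
  have "hs (y \<otimes> x) (v \<otimes> u) = cnj (hs (x \<otimes> y) (u \<otimes> v))"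
    unfolding hs_outer[OF sep] using cinner_commute[of v y] cinner_commute[of x u] by simp
  then show ?thesis by (simp only: P(3) Q(3) cadjoint_outer)
qed

section \<open>The two forms\<close>

text \<open>The column and the row through \<open>e \<otimes> e\<close> define the two factors by \<open>\<psi> (x \<otimes> e) = U x \<otimes> b\<close> and
  \<open>\<psi> (e \<otimes> y) = a \<otimes> W y\<close>; the form restricted to them makes \<open>U\<close> and \<open>W\<close> preserve inner products up
  to \<open>c\<close>. Since \<open>x \<otimes> y\<close> shares its row with \<open>x \<otimes> e\<close> and its column with \<open>e \<otimes> y\<close>, its image is
  \<open>U x \<otimes> W y\<close> up to a phase, and this phase is rigid.\<close>
lemma range_kernel_preserving_form:
  fixes \<psi> :: "('a::complex_inner \<Rightarrow> 'a) \<Rightarrow> ('a \<Rightarrow> 'a)"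
  assumes sep: "separable_space (euclidean :: 'a topology)"
    and c: "c = id \<or> c = cnj"
    and im: "\<psi> ` PI1 = PI1"
    and hs: "\<And>P Q. P \<in> PI1 \<Longrightarrow> Q \<in> PI1 \<Longrightarrow> hs (\<psi> P) (\<psi> Q) = c (hs P Q)"
    and range: "\<And>P Q. P \<in> PI1 \<Longrightarrow> Q \<in> PI1 \<Longrightarrow> range P = range Q \<Longrightarrow> range (\<psi> P) = range (\<psi> Q)"
    and kernel: "\<And>P Q. P \<in> PI1 \<Longrightarrow> Q \<in> PI1 \<Longrightarrow> kernel P = kernel Q \<Longrightarrow> kernel (\<psi> P) = kernel (\<psi> Q)"
    and e: "norm (e :: 'a) = 1"
  obtains U W where "bij U" "\<And>x y. cinner (U x) (U y) = c (cinner x y)"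
    "bij W" "\<And>x y. cinner (W x) (W y) = c (cinner x y)"
    "\<And>x y. norm x = 1 \<Longrightarrow> norm y = 1 \<Longrightarrow> \<psi> (x \<otimes> y) = U x \<otimes> W y"
proof -
  have c_mult: "c (a * b) = c a * c b" and c_0: "c a = 0 \<longleftrightarrow> a = 0" and c_1: "c 1 = 1" for a b
    using c by auto
  have \<psi>: "\<psi> (x \<otimes> y) \<in> PI1" if "norm x = 1" "norm y = 1" for x y
    using im outer_in_PI1[OF that] by blast
  have hs': "hs (\<psi> (x \<otimes> y)) (\<psi> (u \<otimes> v)) = c (cinner u x) * c (cinner y v)"
    if "norm x = 1" "norm y = 1" "norm u = 1" "norm v = 1" for x y u v
    using hs[OF outer_in_PI1 outer_in_PI1] that by (simp add: hs_outer[OF sep] c_mult)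
  obtain a b where ab: "norm a = 1" "norm b = 1" "\<psi> (e \<otimes> e) = a \<otimes> b"
    using PI1_outer[OF \<psi>[OF e e]] .
  have "\<exists>u. norm u = 1 \<and> \<psi> (x \<otimes> e) = u \<otimes> b" if x: "norm x = 1" for x
  proof -
    have "kernel (\<psi> (x \<otimes> e)) = kernel (a \<otimes> b)"
      using kernel[OF outer_in_PI1[OF x e] outer_in_PI1[OF e e]] kernel_outer_eq_iff[OF x e e e] e ab(3)
      by (simp add: cinner_self_unit)
    then show ?thesis using same_kernel_outer[OF \<psi>[OF x e] ab(1,2)] by blast
  qed
  then obtain U where U: "\<And>x. norm x = 1 \<Longrightarrow> norm (U x) = 1"
    "\<And>x. norm x = 1 \<Longrightarrow> \<psi> (x \<otimes> e) = U x \<otimes> b"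
    by metis
  have "\<exists>w. norm w = 1 \<and> \<psi> (e \<otimes> y) = a \<otimes> w" if y: "norm y = 1" for y
  proof -
    have "range (\<psi> (e \<otimes> y)) = range (a \<otimes> b)"
      using range[OF outer_in_PI1[OF e y] outer_in_PI1[OF e e]] range_outer_eq_iff[OF e y e e] e ab(3)
      by (simp add: cinner_self_unit)
    then show ?thesis using same_range_outer[OF \<psi>[OF e y] ab(1,2)] by blast
  qed
  then obtain W where W: "\<And>y. norm y = 1 \<Longrightarrow> norm (W y) = 1"
    "\<And>y. norm y = 1 \<Longrightarrow> \<psi> (e \<otimes> y) = a \<otimes> W y"
    by metis
  have Ue: "U e = a" and We: "W e = b"
    using outer_cancel(1)[OF ab(2)] outer_cancel(2)[OF ab(1)] U(2)[OF e] W(2)[OF e] ab(3) by metis+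
  have U_inner: "cinner (U x) (U y) = c (cinner x y)" if "norm x = 1" "norm y = 1" for x y
    using hs'[OF that(2) e that(1) e] that ab(2) e
    by (simp add: U(2) hs_outer[OF sep] cinner_self_unit c_1)
  have W_inner: "cinner (W x) (W y) = c (cinner x y)" if "norm x = 1" "norm y = 1" for x y
    using hs'[OF e that(1) e that(2)] that ab(1) e
    by (simp add: W(2) hs_outer[OF sep] cinner_self_unit c_1)
  have "\<exists>p. \<psi> (x \<otimes> y) = (p *\<^sub>C U x) \<otimes> W y" if x: "norm x = 1" and y: "norm y = 1" for x y
  proof -
    have "range (\<psi> (x \<otimes> y)) = range (U x \<otimes> b)"
      using range[OF outer_in_PI1[OF x y] outer_in_PI1[OF x e]] range_outer_eq_iff[OF x y x e] x U(2)[OF x]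
      by (simp add: cinner_self_unit)
    then obtain v where v: "norm v = 1" "\<psi> (x \<otimes> y) = U x \<otimes> v"
      using same_range_outer[OF \<psi>[OF x y] U(1)[OF x] ab(2)] by blast
    have "kernel (U x \<otimes> v) = kernel (a \<otimes> W y)"
      using kernel[OF outer_in_PI1[OF x y] outer_in_PI1[OF e y]] kernel_outer_eq_iff[OF x y e y] y
        W(2)[OF y] v(2)
      by (simp add: cinner_self_unit)
    then have "cmod (cinner v (W y)) = 1"
      using kernel_outer_eq_iff[OF U(1)[OF x] v(1) ab(1) W(1)[OF y]] by blast
    then have "v = cinner v (W y) *\<^sub>C W y" by (rule unit_aligned[OF v(1) W(1)[OF y]])
    then have "\<psi> (x \<otimes> y) = (cnj (cinner v (W y)) *\<^sub>C U x) \<otimes> W y"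
      using v(2) by (metis outer_scaleC_right)
    then show ?thesis by blast
  qed
  \<comment> \<open>Comparing the form of both sides shows that the phase \<open>p\<close> is constant, hence 1 as at \<open>(e, e)\<close>.\<close>
  then obtain p where p: "\<And>x y. norm x = 1 \<Longrightarrow> norm y = 1 \<Longrightarrow> \<psi> (x \<otimes> y) = (p x y *\<^sub>C U x) \<otimes> W y"
    by metis
  have "p x y = 1" if "norm x = 1" "norm y = 1" for x y
  proof (rule phase_rigidity[where p = p, OF _ e _ that])
    fix x y u v :: 'a
    assume n: "norm x = 1" "norm y = 1" "norm u = 1" "norm v = 1"
      and nz: "cinner x u \<noteq> 0" "cinner y v \<noteq> 0"
    have "cnj (p x y) * p u v * (c (cinner u x) * c (cinner y v)) = c (cinner u x) * c (cinner y v)"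
      using hs'[OF n] n by (auto simp: p hs_outer[OF sep] cinner_simps U_inner W_inner)
    moreover have "c (cinner u x) * c (cinner y v) \<noteq> 0"
      using nz by (simp add: c_0 cinner_swap_zero[of u])
    ultimately show "cnj (p x y) * p u v = 1" by simp
  next
    have "(p e e *\<^sub>C a) \<otimes> b = a \<otimes> b"
      using p[OF e e] ab(3) by (simp only: Ue We)
    then have "p e e *\<^sub>C a = 1 *\<^sub>C a"
      using outer_cancel(1)[OF ab(2)] by (simp only: scaleC_one)
    moreover have "a \<noteq> 0" using ab(1) by auto
    ultimately show "p e e = 1" 
      by (simp only: complex_vector.scale_cancel_right) simp
  qed
  then have form: "\<psi> (x \<otimes> y) = U x \<otimes> W y" if "norm x = 1" "norm y = 1" for x y
    using p that by simp
  \<comment> \<open>Surjectivity of \<open>\<psi>\<close> passes to both factors, first up to a phase.\<close>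
  have preimage: "\<exists>x y. norm x = 1 \<and> norm y = 1 \<and> U x \<otimes> W y = u \<otimes> v"
    if "norm u = 1" "norm v = 1" for u v
  proof -
    have "u \<otimes> v \<in> \<psi> ` PI1" using im outer_in_PI1[OF that] by simp
    then obtain P where P: "P \<in> PI1" "\<psi> P = u \<otimes> v" by (metis imageE)
    obtain x y where xy: "norm x = 1" "norm y = 1" "P = x \<otimes> y" using PI1_outer[OF P(1)] .
    have "U x \<otimes> W y = u \<otimes> v" using form[OF xy(1,2)] P(2) xy(3) by simp
    then show ?thesis using xy(1,2) by blast
  qed
  have U_surj: "\<exists>x. norm x = 1 \<and> U x = w" if w: "norm w = 1" for w
  proof -
    obtain x y where xy: "norm x = 1" "norm y = 1" "U x \<otimes> W y = w \<otimes> b"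
      using preimage[OF w ab(2)] by blast
    then have "cmod (cinner w (U x)) = 1"
      using range_outer_eq_iff[OF w ab(2) U(1)[OF xy(1)] W(1)[OF xy(2)]] by simp
    then show ?thesis using aligned_with_image[OF c U_inner w xy(1)] by blast
  qed
  have W_surj: "\<exists>x. norm x = 1 \<and> W x = w" if w: "norm w = 1" for w
  proof -
    obtain x y where xy: "norm x = 1" "norm y = 1" "U x \<otimes> W y = a \<otimes> w"
      using preimage[OF ab(1) w] by blast
    then have "cmod (cinner w (W y)) = 1"
      using kernel_outer_eq_iff[OF ab(1) w U(1)[OF xy(1)] W(1)[OF xy(2)]] by simp
    then show ?thesis using aligned_with_image[OF c W_inner w xy(2)] by blast
  qed
  obtain U' where U': "\<And>x. norm x = 1 \<Longrightarrow> U' x = U x" "bij U'"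
    "\<And>x y. cinner (U' x) (U' y) = c (cinner x y)"
    using sphere_map_extends[of c U, OF c U_inner U_surj] by blast
  obtain W' where W': "\<And>x. norm x = 1 \<Longrightarrow> W' x = W x" "bij W'"
    "\<And>x y. cinner (W' x) (W' y) = c (cinner x y)"
    using sphere_map_extends[of c W, OF c W_inner W_surj] by blast
  show thesis
    using that[OF U'(2,3) W'(2,3)] form U'(1) W'(1) by simp
qed

theorem theorem2:
  fixes \<phi> :: "('h::complex_hilbert_space \<Rightarrow> 'h) \<Rightarrow> ('h \<Rightarrow> 'h)"
  assumes "separable_space (euclidean :: 'h topology)"
    and "bij_betw \<phi> PI1 PI1"
    and "\<And>P Q. P \<in> PI1 \<Longrightarrow> Q \<in> PI1 \<Longrightarrow>
           tr (cadjoint (\<phi> P) \<circ> \<phi> Q) = tr (cadjoint P \<circ> Q)"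
  shows "(\<exists>U V. unitary U \<and> unitary V \<and> (\<forall>R\<in>PI1. \<phi> R = U \<circ> R \<circ> V)) \<or>
         (\<exists>U V. antiunitary U \<and> antiunitary V \<and> (\<forall>R\<in>PI1. \<phi> R = U \<circ> cadjoint R \<circ> V))"
proof (cases "\<exists>e :: 'h. norm e = 1")
  \<comment> \<open>On the zero space there is no operator of rank one.\<close>
  case False
  then have "PI1 = ({} :: ('h \<Rightarrow> 'h) set)" using PI1_outer by blast
  moreover have "unitary (id :: 'h \<Rightarrow> 'h)" by (rule unitary_if_cinner) simp_all
  ultimately show ?thesis by blast
next
  case True
  then obtain e :: 'h where e: "norm e = 1" by blast
  note sep = assms(1)
  have im: "\<phi> ` PI1 = PI1" using assms(2) by (simp add: bij_betw_def)
  have \<phi>: "\<phi> P \<in> PI1" if "P \<in> PI1" for P using im that by blast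
  from range_kernel_preserved_or_swapped[OF assms] show ?thesis
  proof
    assume *: "\<forall>P\<in>PI1. \<forall>Q\<in>PI1. (range P = range Q \<longrightarrow> range (\<phi> P) = range (\<phi> Q)) \<and>
       (kernel P = kernel Q \<longrightarrow> kernel (\<phi> P) = kernel (\<phi> Q))"
    obtain U W where UW: "bij U" "\<And>x y. cinner (U x) (U y) = id (cinner x y)"
      "bij W" "\<And>x y. cinner (W x) (W y) = id (cinner x y)"
      "\<And>x y. norm x = 1 \<Longrightarrow> norm y = 1 \<Longrightarrow> \<phi> (x \<otimes> y) = U x \<otimes> W y"
    proof (rule range_kernel_preserving_form[OF sep _ im _ _ _ e, of id])
      fix P Q :: "'h \<Rightarrow> 'h" assume PQ: "P \<in> PI1" "Q \<in> PI1"
      show "hs (\<phi> P) (\<phi> Q) = id (hs P Q)" using assms(3)[OF PQ] by simp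
      show "range P = range Q \<Longrightarrow> range (\<phi> P) = range (\<phi> Q)"
        "kernel P = kernel Q \<Longrightarrow> kernel (\<phi> P) = kernel (\<phi> Q)"
        using * PQ by blast+
    qed auto
    have W_inv: "W (inv W x) = x" for x using UW(3) by (simp add: bij_is_surj surj_f_inv_f)
    interpret U: Vector_Spaces.linear scaleC scaleC U
      using unitary_if_cinner[OF UW(1)] UW(2) by (simp add: unitary_def)
    have "unitary U" using unitary_if_cinner[OF UW(1)] UW(2) by simp
    moreover have "cinner (inv W x) (inv W y) = cinner x y" for x y
      using UW(4)[of "inv W x" "inv W y"] by (simp add: W_inv)
    then have "unitary (inv W)" by (rule unitary_if_cinner[OF bij_imp_bij_inv[OF UW(3)]])
    moreover have "\<phi> R = U \<circ> R \<circ> inv W" if R: "R \<in> PI1" for R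
    proof -
      obtain x y where xy: "norm x = 1" "norm y = 1" "R = x \<otimes> y" using PI1_outer[OF R] .
      have "cinner z (W y) = cinner (inv W z) y" for z
        using UW(4)[of "inv W z" y] by (simp add: W_inv)
      then show ?thesis
        using UW(5)[OF xy(1,2)] xy(3) by (auto simp: outer_def U.scale)
    qed
    ultimately show ?thesis by blast
  next
    \<comment> \<open>Taking adjoints restores the roles of ranges and kernels, and conjugates the form.\<close>
    assume *: "\<forall>P\<in>PI1. \<forall>Q\<in>PI1. (range P = range Q \<longrightarrow> kernel (\<phi> P) = kernel (\<phi> Q)) \<and>
       (kernel P = kernel Q \<longrightarrow> range (\<phi> P) = range (\<phi> Q))"
    define \<psi> where "\<psi> P = cadjoint (\<phi> P)" for P
    have "\<psi> = cadjoint \<circ> \<phi>" by (auto simp: \<psi>_def)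
    then have im\<psi>: "\<psi> ` PI1 = PI1"
      by (simp only: image_comp[symmetric] im cadjoint_image_PI1)
    obtain U W where UW: "bij U" "\<And>x y. cinner (U x) (U y) = cnj (cinner x y)"
      "bij W" "\<And>x y. cinner (W x) (W y) = cnj (cinner x y)"
      "\<And>x y. norm x = 1 \<Longrightarrow> norm y = 1 \<Longrightarrow> \<psi> (x \<otimes> y) = U x \<otimes> W y"
    proof (rule range_kernel_preserving_form[OF sep _ im\<psi> _ _ _ e, of cnj])
      fix P Q :: "'h \<Rightarrow> 'h" assume PQ: "P \<in> PI1" "Q \<in> PI1"
      show "hs (\<psi> P) (\<psi> Q) = cnj (hs P Q)"
        unfolding \<psi>_def hs_cadjoint[OF sep \<phi>[OF PQ(1)] \<phi>[OF PQ(2)]] assms(3)[OF PQ] ..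
      show "range P = range Q \<Longrightarrow> range (\<psi> P) = range (\<psi> Q)"
        "kernel P = kernel Q \<Longrightarrow> kernel (\<psi> P) = kernel (\<psi> Q)"
        unfolding \<psi>_def cadjoint_swaps_range_kernel[OF \<phi>[OF PQ(1)] \<phi>[OF PQ(2)]]
        using * PQ by blast+
    qed auto
    have U_inv: "U (inv U x) = x" for x using UW(1) by (simp add: bij_is_surj surj_f_inv_f)
    have W: "antiunitary W" using antiunitary_if_cinner[OF UW(3)] UW(4) by simp
    then have W_scale: "W (k *\<^sub>C x) = cnj k *\<^sub>C W x" for k x
      by (simp add: antiunitary_def antilinear_def)
    have "cinner (inv U x) (inv U y) = cnj (cinner x y)" for x y
      using UW(2)[of "inv U x" "inv U y"] by (simp add: U_inv)
    then have "antiunitary (inv U)" by (rule antiunitary_if_cinner[OF bij_imp_bij_inv[OF UW(1)]])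
    moreover have "\<phi> R = W \<circ> cadjoint R \<circ> inv U" if R: "R \<in> PI1" for R
    proof -
      obtain x y where xy: "norm x = 1" "norm y = 1" "R = x \<otimes> y" using PI1_outer[OF R] .
      have "\<phi> R = cadjoint (\<psi> R)" using cadjoint_cadjoint_PI1[OF \<phi>[OF R]] by (simp add: \<psi>_def)
      then have "\<phi> R = W y \<otimes> U x" using UW(5)[OF xy(1,2)] xy(3) by (simp add: cadjoint_outer)
      moreover have "cinner z (U x) = cnj (cinner (inv U z) x)" for z
        using UW(2)[of "inv U z" x] by (simp add: U_inv)
      ultimately show ?thesis
        unfolding xy(3) cadjoint_outer by (auto simp: outer_def W_scale)
    qed
    ultimately show ?thesis using W by blast
  qed
qed

end
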